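(* Let $M$ be an abelian group and $G = \bigoplus_{i=1}^k \mathbb{Z}/n_i\mathbb{Z}\oplus \mathbb{Z}^r$ with $n_1 \mid n_2 \mid \cdots \mid n_k$ positive integers. Let $m_i \in M[\gcd(2n_i, n_i^2)]$ $(1\le i\le k)$, $b_{ij} \in M[n_i]$ $(1 \leq i < j \leq k)$, $\ell_j \in M$ $(1\le j\le r)$, $f_{jl} \in M$ $(1\le j<l\le r)$ and $t_{ij} \in M[n_i]$ $(1\le i\le k,\ 1\le j\le r)$, and let $q\in\operatorname{Quad}(G,M)$ be the quadratic form $$q(a_1,\ldots,a_k,x_1,\ldots,x_r)=\sum_{i} a_i^2 m_i+\sum_{i<j}a_ia_jb_{ij}+\sum_j x_j^2\ell_j+\sum_{j<l}x_jx_lf_{jl}+\sum_{i,j}a_ix_jt_{ij}.$$ For $g = (a_1,\ldots,a_k,x_1,\ldots,x_r)$, $g' = (a'_1,\ldots,a'_k,x'_1,\ldots,x'_r)$, $g''=(a''_1,\ldots,a''_k,x''_1,\ldots,x''_r)$ in $G$ define $$c(g,g') = \sum_{i=1}^k a_i a'_i m_i + \sum_{1 \leq i < j \leq k} a_i a'_j b_{ij}+ \sum_{j=1}^r x_j x'_j \ell_j + \sum_{1 \leq j < l \leq r} x_j x'_l f_{jl}+ \sum_{i=1}^k \sum_{j=1}^r a_i x'_j t_{ij},$$ $$h(g,g',g'') = \sum_{i=1}^k h_i(a_i,a'_i,a''_i),\qquad h_i(a,a',a'')=\begin{cases} a\,n_i m_i & \text{if } a'+a''\geq n_i,\\ 0&\text{otherwise,}\end{cases}$$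 where elements of $\mathbb{Z}/n_i\mathbb{Z}$ are represented by integers in $\{0,\ldots,n_i-1\}$. Then $(h,c)$ is a 2-abelian 3-cocycle on $G$ with values in $M$, it is in normal form, and its trace $g\mapsto c(g,g)$ equals $q$.
   Context: $M[s]=\{m\in M: sm=0\}$. $\operatorname{Quad}(G,M)$ is the group of functions $q:G\to M$ with $q(-a)=q(a)$ and $q(a_1+a_2)-q(a_1)-q(a_2)$ bilinear in $(a_1,a_2)$. A 2-abelian 3-cocycle on an abelian group $G$ with values in $M$ is a pair $(h,c)$ of functions $h:G^3\to M$, $c:G^2\to M$ such that $h(g_1,g_2,g_3) + h(g_1,g_2+g_3,g_4) + h(g_2,g_3,g_4) = h(g_1+g_2,g_3,g_4) + h(g_1,g_2,g_3+g_4)$ for all $g_i$, and for all $x,y,z\in G$: $h(y,z,x)+c(x,y+z)+h(x,y,z)=c(x,z)+h(y,x,z)+c(x,y)$ and $-h(z,x,y)+c(x+y,z)-h(x,y,z)=c(x,z)-h(x,z,y)+c(y,z)$. It is in normal form if $h(x,y,z) = c(x,y) + c(x,z) - c(x,y+z)$ and $h(z,x,y) = c(x+y,z) - c(x,z) - c(y,z)$ for all $x,y,z \in G$. *)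

theory Defs
  imports "HOL-Algebra.Product_Groups" "HOL-Algebra.Ring"
begin

text \<open>
  The group \<open>G\<close> is a HOL-Algebra group, so its operation (written \<open>+\<close> in the
  mathematics) appears as \<open>\<otimes>\<close>. The coefficient group \<open>M\<close> is an
  \<^locale>\<open>abelian_group\<close>, which gives it additive notation
  and integer multiples \<open>[s] \<cdot> m\<close>; that locale constrains only the additive part of the
  underlying record.
\<close>

definition torsion_part :: "('m, 'z) ring_scheme \<Rightarrow> nat \<Rightarrow> 'm set" where
  "torsion_part M s = {m \<in> carrier M. [s] \<cdot>\<^bsub>M\<^esub> m = \<zero>\<^bsub>M\<^esub>}"

definition bilinear_map ::
  "('g, 'y) monoid_scheme \<Rightarrow> ('m, 'z) ring_scheme \<Rightarrow> ('g \<Rightarrow> 'g \<Rightarrow> 'm) \<Rightarrow> bool" where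
  "bilinear_map G M B \<longleftrightarrow>
     (\<forall>x\<in>carrier G. (\<lambda>y. B x y) \<in> hom G (add_monoid M)) \<and>
     (\<forall>y\<in>carrier G. (\<lambda>x. B x y) \<in> hom G (add_monoid M))"

definition Quad :: "('g, 'y) monoid_scheme \<Rightarrow> ('m, 'z) ring_scheme \<Rightarrow> ('g \<Rightarrow> 'm) set" where
  "Quad G M = {q \<in> carrier G \<rightarrow> carrier M.
     (\<forall>a\<in>carrier G. q (inv\<^bsub>G\<^esub> a) = q a) \<and>
     bilinear_map G M (\<lambda>a1 a2. q (a1 \<otimes>\<^bsub>G\<^esub> a2) \<ominus>\<^bsub>M\<^esub> q a1 \<ominus>\<^bsub>M\<^esub> q a2)}"

definition two_abelian_3_cocycle ::
  "('g, 'y) monoid_scheme \<Rightarrow> ('m, 'z) ring_scheme \<Rightarrow> ('g \<Rightarrow> 'g \<Rightarrow> 'g \<Rightarrow> 'm) \<Rightarrow> ('g \<Rightarrow> 'g \<Rightarrow> 'm) \<Rightarrow> bool"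
where
  "two_abelian_3_cocycle G M h c \<longleftrightarrow>
     h \<in> carrier G \<rightarrow> carrier G \<rightarrow> carrier G \<rightarrow> carrier M \<and>
     c \<in> carrier G \<rightarrow> carrier G \<rightarrow> carrier M \<and>
     (\<forall>g1\<in>carrier G. \<forall>g2\<in>carrier G. \<forall>g3\<in>carrier G. \<forall>g4\<in>carrier G.
        h g1 g2 g3 \<oplus>\<^bsub>M\<^esub> h g1 (g2 \<otimes>\<^bsub>G\<^esub> g3) g4 \<oplus>\<^bsub>M\<^esub> h g2 g3 g4
        = h (g1 \<otimes>\<^bsub>G\<^esub> g2) g3 g4 \<oplus>\<^bsub>M\<^esub> h g1 g2 (g3 \<otimes>\<^bsub>G\<^esub> g4)) \<and>
     (\<forall>x\<in>carrier G. \<forall>y\<in>carrier G. \<forall>z\<in>carrier G.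
        h y z x \<oplus>\<^bsub>M\<^esub> c x (y \<otimes>\<^bsub>G\<^esub> z) \<oplus>\<^bsub>M\<^esub> h x y z
        = c x z \<oplus>\<^bsub>M\<^esub> h y x z \<oplus>\<^bsub>M\<^esub> c x y) \<and>
     (\<forall>x\<in>carrier G. \<forall>y\<in>carrier G. \<forall>z\<in>carrier G.
        (\<ominus>\<^bsub>M\<^esub> (h z x y)) \<oplus>\<^bsub>M\<^esub> c (x \<otimes>\<^bsub>G\<^esub> y) z \<ominus>\<^bsub>M\<^esub> h x y z
        = c x z \<ominus>\<^bsub>M\<^esub> h x z y \<oplus>\<^bsub>M\<^esub> c y z)"

definition in_normal_form ::
  "('g, 'y) monoid_scheme \<Rightarrow> ('m, 'z) ring_scheme \<Rightarrow> ('g \<Rightarrow> 'g \<Rightarrow> 'g \<Rightarrow> 'm) \<Rightarrow> ('g \<Rightarrow> 'g \<Rightarrow> 'm) \<Rightarrow> bool"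
where
  "in_normal_form G M h c \<longleftrightarrow>
     (\<forall>x\<in>carrier G. \<forall>y\<in>carrier G. \<forall>z\<in>carrier G.
        h x y z = c x y \<oplus>\<^bsub>M\<^esub> c x z \<ominus>\<^bsub>M\<^esub> c x (y \<otimes>\<^bsub>G\<^esub> z) \<and>
        h z x y = c (x \<otimes>\<^bsub>G\<^esub> y) z \<ominus>\<^bsub>M\<^esub> c x z \<ominus>\<^bsub>M\<^esub> c y z)"

text \<open>
  An element of the group below is a pair \<open>(a, x)\<close> of integer-valued families, with \<open>a\<close> indexed by
  \<open>{1..k}\<close> and \<open>x\<close> by \<open>{1..r}\<close> (both \<^const>\<open>undefined\<close> elsewhere).
  For \<open>n i > 0\<close> the carrier of \<open>integer_mod_group (n i)\<close> is \<open>{0..<n i}\<close>, so \<open>a i\<close> is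
  the canonical integer representative of the residue class.
\<close>

type_synonym fg_elem = "(nat \<Rightarrow> int) \<times> (nat \<Rightarrow> int)"

definition fg_group :: "nat \<Rightarrow> (nat \<Rightarrow> nat) \<Rightarrow> nat \<Rightarrow> fg_elem monoid" where
  "fg_group k n r =
     sum_group {1..k} (\<lambda>i. integer_mod_group (n i)) \<times>\<times> sum_group {1..r} (\<lambda>_. integer_group)"

definition q_form ::
  "('m, 'z) ring_scheme \<Rightarrow> nat \<Rightarrow> nat \<Rightarrow> (nat \<Rightarrow> 'm) \<Rightarrow> (nat \<Rightarrow> nat \<Rightarrow> 'm) \<Rightarrow> (nat \<Rightarrow> 'm) \<Rightarrow>
   (nat \<Rightarrow> nat \<Rightarrow> 'm) \<Rightarrow> (nat \<Rightarrow> nat \<Rightarrow> 'm) \<Rightarrow> fg_elem \<Rightarrow> 'm" where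
  "q_form M k r m b ell f t = (\<lambda>(a, x).
     (\<Oplus>\<^bsub>M\<^esub>i\<in>{1..k}. [((a i)\<^sup>2)] \<cdot>\<^bsub>M\<^esub> m i)
     \<oplus>\<^bsub>M\<^esub> (\<Oplus>\<^bsub>M\<^esub>i\<in>{1..k}. \<Oplus>\<^bsub>M\<^esub>j\<in>{i<..k}. [(a i * a j)] \<cdot>\<^bsub>M\<^esub> b i j)
     \<oplus>\<^bsub>M\<^esub> (\<Oplus>\<^bsub>M\<^esub>j\<in>{1..r}. [((x j)\<^sup>2)] \<cdot>\<^bsub>M\<^esub> ell j)
     \<oplus>\<^bsub>M\<^esub> (\<Oplus>\<^bsub>M\<^esub>j\<in>{1..r}. \<Oplus>\<^bsub>M\<^esub>l\<in>{j<..r}. [(x j * x l)] \<cdot>\<^bsub>M\<^esub> f j l)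
     \<oplus>\<^bsub>M\<^esub> (\<Oplus>\<^bsub>M\<^esub>i\<in>{1..k}. \<Oplus>\<^bsub>M\<^esub>j\<in>{1..r}. [(a i * x j)] \<cdot>\<^bsub>M\<^esub> t i j))"

definition c_map ::
  "('m, 'z) ring_scheme \<Rightarrow> nat \<Rightarrow> nat \<Rightarrow> (nat \<Rightarrow> 'm) \<Rightarrow> (nat \<Rightarrow> nat \<Rightarrow> 'm) \<Rightarrow> (nat \<Rightarrow> 'm) \<Rightarrow>
   (nat \<Rightarrow> nat \<Rightarrow> 'm) \<Rightarrow> (nat \<Rightarrow> nat \<Rightarrow> 'm) \<Rightarrow> fg_elem \<Rightarrow> fg_elem \<Rightarrow> 'm" where
  "c_map M k r m b ell f t = (\<lambda>(a, x) (a', x').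
     (\<Oplus>\<^bsub>M\<^esub>i\<in>{1..k}. [(a i * a' i)] \<cdot>\<^bsub>M\<^esub> m i)
     \<oplus>\<^bsub>M\<^esub> (\<Oplus>\<^bsub>M\<^esub>i\<in>{1..k}. \<Oplus>\<^bsub>M\<^esub>j\<in>{i<..k}. [(a i * a' j)] \<cdot>\<^bsub>M\<^esub> b i j)
     \<oplus>\<^bsub>M\<^esub> (\<Oplus>\<^bsub>M\<^esub>j\<in>{1..r}. [(x j * x' j)] \<cdot>\<^bsub>M\<^esub> ell j)
     \<oplus>\<^bsub>M\<^esub> (\<Oplus>\<^bsub>M\<^esub>j\<in>{1..r}. \<Oplus>\<^bsub>M\<^esub>l\<in>{j<..r}. [(x j * x' l)] \<cdot>\<^bsub>M\<^esub> f j l)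
     \<oplus>\<^bsub>M\<^esub> (\<Oplus>\<^bsub>M\<^esub>i\<in>{1..k}. \<Oplus>\<^bsub>M\<^esub>j\<in>{1..r}. [(a i * x' j)] \<cdot>\<^bsub>M\<^esub> t i j))"

definition h_component ::
  "('m, 'z) ring_scheme \<Rightarrow> nat \<Rightarrow> 'm \<Rightarrow> int \<Rightarrow> int \<Rightarrow> int \<Rightarrow> 'm" where
  "h_component M n m a a' a'' =
     (if a' + a'' \<ge> int n then [(a * int n)] \<cdot>\<^bsub>M\<^esub> m else \<zero>\<^bsub>M\<^esub>)"

definition h_map ::
  "('m, 'z) ring_scheme \<Rightarrow> nat \<Rightarrow> (nat \<Rightarrow> nat) \<Rightarrow> (nat \<Rightarrow> 'm) \<Rightarrow> fg_elem \<Rightarrow> fg_elem \<Rightarrow> fg_elem \<Rightarrow> 'm" where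
  "h_map M k n m = (\<lambda>(a, x) (a', x') (a'', x'').
     \<Oplus>\<^bsub>M\<^esub>i\<in>{1..k}. h_component M (n i) (m i) (a i) (a' i) (a'' i))"

end

theory Submission
  imports Defs
begin

text \<open>
  If \<open>(h, c)\<close> satisfies the normal form equations and \<open>h\<close> is additive in its first argument, then
  the cocycle and hexagon identities, and the fact that \<open>g \<mapsto> c(g, g)\<close> is a quadratic form with
  polarization \<open>c(x, y) + c(y, x)\<close>, are formal consequences. These hypotheses are preserved by sums
  of pairs, so it suffices to check them for each summand of \<open>c\<close>. All summands are biadditive
  (hence belong to \<open>h = 0\<close>), except the diagonal ones on \<open>\<int>/n\<int>\<close>: there a carry in the second
  argument contributes \<open>a n m = - a n m\<close> since \<open>2 n m = 0\<close>, and this is additive in \<open>a\<close> modulo \<open>n\<close>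
  since \<open>n\<^sup>2 m = 0\<close>.
\<close>

section \<open>Formal consequences of the normal form equations\<close>

locale group_with_coefficients =
  G?: comm_group G + M: abelian_group M for G (structure) and M (structure)

text \<open>The equations are stated without subtraction so that sums of pairs stay within
  the commutative monoid laws.\<close>

locale additive_normal_pair = group_with_coefficients G M
  for G (structure) and M (structure) and h and c +
  assumes h_closed [simp]:
      "\<lbrakk>x \<in> carrier G; y \<in> carrier G; z \<in> carrier G\<rbrakk> \<Longrightarrow> h x y z \<in> carrier M"
    and c_closed [simp]: "\<lbrakk>x \<in> carrier G; y \<in> carrier G\<rbrakk> \<Longrightarrow> c x y \<in> carrier M"
    and h_additive: "\<lbrakk>w \<in> carrier G; x \<in> carrier G; y \<in> carrier G; z \<in> carrier G\<rbrakk>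
      \<Longrightarrow> h (w \<otimes> x) y z = h w y z \<oplus>\<^bsub>M\<^esub> h x y z"
    and c_right: "\<lbrakk>x \<in> carrier G; y \<in> carrier G; z \<in> carrier G\<rbrakk>
      \<Longrightarrow> h x y z \<oplus>\<^bsub>M\<^esub> c x (y \<otimes> z) = c x y \<oplus>\<^bsub>M\<^esub> c x z"
    and c_left: "\<lbrakk>x \<in> carrier G; y \<in> carrier G; z \<in> carrier G\<rbrakk>
      \<Longrightarrow> c (x \<otimes> y) z = h z x y \<oplus>\<^bsub>M\<^esub> (c x z \<oplus>\<^bsub>M\<^esub> c y z)"
begin

text \<open>The right-hand side of \<open>c_right\<close> and the product
  \<open>y \<otimes> z\<close> are both symmetric in the last two arguments, so
  \<open>c x (y \<otimes> z)\<close> cancels.\<close>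

lemma h_commute:
  assumes "x \<in> carrier G" "y \<in> carrier G" "z \<in> carrier G"
  shows "h x y z = h x z y"
proof -
  have "h x y z \<oplus>\<^bsub>M\<^esub> c x (y \<otimes> z) = h x z y \<oplus>\<^bsub>M\<^esub> c x (y \<otimes> z)"
    using c_right[of x y z] c_right[of x z y] assms by (simp add: G.m_comm M.a_comm)
  then show ?thesis using assms by simp
qed

lemma h_eq:
  assumes "x \<in> carrier G" "y \<in> carrier G" "z \<in> carrier G"
  shows "h x y z = c x y \<oplus>\<^bsub>M\<^esub> c x z \<ominus>\<^bsub>M\<^esub> c x (y \<otimes> z)"
  using assms by (simp add: c_right[symmetric] a_minus_def M.a_assoc M.r_neg)

lemma normal_form: "in_normal_form G M h c"
  unfolding in_normal_form_def
proof (intro ballI conjI)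
  fix x y z assume "x \<in> carrier G" "y \<in> carrier G" "z \<in> carrier G"
  note xyz = this
  show "h x y z = c x y \<oplus>\<^bsub>M\<^esub> c x z \<ominus>\<^bsub>M\<^esub> c x (y \<otimes> z)" by (rule h_eq) fact+
  have "c (x \<otimes> y) z \<ominus>\<^bsub>M\<^esub> c x z \<ominus>\<^bsub>M\<^esub> c y z
      = h z x y \<oplus>\<^bsub>M\<^esub> (c x z \<ominus>\<^bsub>M\<^esub> c x z) \<oplus>\<^bsub>M\<^esub> (c y z \<ominus>\<^bsub>M\<^esub> c y z)"
    using xyz by (simp add: c_left a_minus_def M.a_ac)
  then show "h z x y = c (x \<otimes> y) z \<ominus>\<^bsub>M\<^esub> c x z \<ominus>\<^bsub>M\<^esub> c y z"
    using xyz by (simp add: a_minus_def M.r_neg)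
qed

lemma pentagon:
  assumes "g1 \<in> carrier G" "g2 \<in> carrier G" "g3 \<in> carrier G" "g4 \<in> carrier G"
  shows "h g1 g2 g3 \<oplus>\<^bsub>M\<^esub> h g1 (g2 \<otimes> g3) g4 \<oplus>\<^bsub>M\<^esub> h g2 g3 g4
    = h (g1 \<otimes> g2) g3 g4 \<oplus>\<^bsub>M\<^esub> h g1 g2 (g3 \<otimes> g4)"
proof -
  \<comment> \<open>For fixed \<open>x\<close>, \<open>h x\<close> is the coboundary of \<open>c x\<close>, hence a 2-cocycle.\<close>
  let ?d = "c g1 (g2 \<otimes> g3) \<oplus>\<^bsub>M\<^esub> c g1 (g3 \<otimes> g4) \<oplus>\<^bsub>M\<^esub> c g1 (g2 \<otimes> g3 \<otimes> g4)"
  have "(h g1 g2 g3 \<oplus>\<^bsub>M\<^esub> h g1 (g2 \<otimes> g3) g4) \<oplus>\<^bsub>M\<^esub> ?d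
      = (h g1 g2 g3 \<oplus>\<^bsub>M\<^esub> c g1 (g2 \<otimes> g3)) \<oplus>\<^bsub>M\<^esub> (h g1 (g2 \<otimes> g3) g4 \<oplus>\<^bsub>M\<^esub> c g1 (g2 \<otimes> g3 \<otimes> g4))
        \<oplus>\<^bsub>M\<^esub> c g1 (g3 \<otimes> g4)"
    using assms by (simp add: M.a_ac)
  also have "\<dots> = (h g1 g3 g4 \<oplus>\<^bsub>M\<^esub> c g1 (g3 \<otimes> g4)) \<oplus>\<^bsub>M\<^esub> (h g1 g2 (g3 \<otimes> g4) \<oplus>\<^bsub>M\<^esub> c g1 (g2 \<otimes> (g3 \<otimes> g4)))
        \<oplus>\<^bsub>M\<^esub> c g1 (g2 \<otimes> g3)"
    using assms by (simp only: c_right G.m_closed) (simp add: M.a_ac)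
  also have "\<dots> = (h g1 g3 g4 \<oplus>\<^bsub>M\<^esub> h g1 g2 (g3 \<otimes> g4)) \<oplus>\<^bsub>M\<^esub> ?d"
    using assms by (simp add: M.a_ac G.m_assoc)
  finally have "h g1 g2 g3 \<oplus>\<^bsub>M\<^esub> h g1 (g2 \<otimes> g3) g4 = h g1 g3 g4 \<oplus>\<^bsub>M\<^esub> h g1 g2 (g3 \<otimes> g4)"
    using assms by simp
  \<comment> \<open>Additivity splits \<open>h (g1 \<otimes> g2) g3 g4\<close>; its
    \<open>g2\<close> part is the third summand on the left.\<close>
  then show ?thesis
    using assms by (simp add: h_additive M.a_ac)
qed

text \<open>By symmetry of \<open>h\<close> in its last two arguments, the first hexagon becomes
  \<open>c_right\<close> with \<open>h y x z\<close> added to both sides, and the second becomes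
  \<open>c_left\<close> with \<open>h x y z\<close> subtracted from both sides.\<close>

lemma cocycle: "two_abelian_3_cocycle G M h c"
  unfolding two_abelian_3_cocycle_def
proof (intro conjI ballI)
  fix x y z assume xyz: "x \<in> carrier G" "y \<in> carrier G" "z \<in> carrier G"
  have "h y z x \<oplus>\<^bsub>M\<^esub> c x (y \<otimes> z) \<oplus>\<^bsub>M\<^esub> h x y z = h y z x \<oplus>\<^bsub>M\<^esub> (h x y z \<oplus>\<^bsub>M\<^esub> c x (y \<otimes> z))"
    using xyz by (simp add: M.a_ac)
  then show "h y z x \<oplus>\<^bsub>M\<^esub> c x (y \<otimes> z) \<oplus>\<^bsub>M\<^esub> h x y z = c x z \<oplus>\<^bsub>M\<^esub> h y x z \<oplus>\<^bsub>M\<^esub> c x y"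
    using xyz by (simp add: c_right h_commute[of y z x] M.a_ac)
  have "(\<ominus>\<^bsub>M\<^esub> (h z x y)) \<oplus>\<^bsub>M\<^esub> c (x \<otimes> y) z = c x z \<oplus>\<^bsub>M\<^esub> c y z"
    using xyz by (simp add: c_left M.a_assoc[symmetric] M.l_neg)
  then show "(\<ominus>\<^bsub>M\<^esub> (h z x y)) \<oplus>\<^bsub>M\<^esub> c (x \<otimes> y) z \<ominus>\<^bsub>M\<^esub> h x y z
      = c x z \<ominus>\<^bsub>M\<^esub> h x z y \<oplus>\<^bsub>M\<^esub> c y z"
    using xyz by (simp add: h_commute[of x y z] a_minus_def M.a_ac)
qed (auto intro: pentagon)

text \<open>Expanding the first slot produces \<open>h (x \<otimes> y) x y\<close>, which additivity
  splits into exactly the two corrections that \<open>c_right\<close> requires to expand the second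
  slot.\<close>

lemma trace_mult:
  assumes "x \<in> carrier G" "y \<in> carrier G"
  shows "c (x \<otimes> y) (x \<otimes> y) = (c x y \<oplus>\<^bsub>M\<^esub> c y x) \<oplus>\<^bsub>M\<^esub> (c x x \<oplus>\<^bsub>M\<^esub> c y y)"
proof -
  have "c (x \<otimes> y) (x \<otimes> y)
      = (h x x y \<oplus>\<^bsub>M\<^esub> c x (x \<otimes> y)) \<oplus>\<^bsub>M\<^esub> (h y x y \<oplus>\<^bsub>M\<^esub> c y (x \<otimes> y))"
    using assms by (simp add: c_left[of x y "x \<otimes> y"] h_additive M.a_ac)
  then show ?thesis
    using assms by (simp add: c_right M.a_ac)
qed

lemma polarization:
  assumes "x \<in> carrier G" "y \<in> carrier G"
  shows "c (x \<otimes> y) (x \<otimes> y) \<ominus>\<^bsub>M\<^esub> c x x \<ominus>\<^bsub>M\<^esub> c y y = c x y \<oplus>\<^bsub>M\<^esub> c y x"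
proof -
  have "c (x \<otimes> y) (x \<otimes> y) \<ominus>\<^bsub>M\<^esub> c x x \<ominus>\<^bsub>M\<^esub> c y y
      = (c x y \<oplus>\<^bsub>M\<^esub> c y x) \<oplus>\<^bsub>M\<^esub> (c x x \<ominus>\<^bsub>M\<^esub> c x x) \<oplus>\<^bsub>M\<^esub> (c y y \<ominus>\<^bsub>M\<^esub> c y y)"
    using assms by (simp add: trace_mult a_minus_def M.a_ac)
  then show ?thesis
    using assms by (simp add: a_minus_def M.r_neg)
qed

text \<open>The failures of additivity of \<open>c\<close> in its two slots are
  \<open>h z x y\<close> and its negative, so they cancel in the symmetrization.\<close>

lemma polar_additive:
  assumes "x \<in> carrier G" "y \<in> carrier G" "z \<in> carrier G"
  shows "c (x \<otimes> y) z \<oplus>\<^bsub>M\<^esub> c z (x \<otimes> y)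
    = (c x z \<oplus>\<^bsub>M\<^esub> c z x) \<oplus>\<^bsub>M\<^esub> (c y z \<oplus>\<^bsub>M\<^esub> c z y)"
proof -
  have "c (x \<otimes> y) z \<oplus>\<^bsub>M\<^esub> c z (x \<otimes> y) = c x z \<oplus>\<^bsub>M\<^esub> c y z \<oplus>\<^bsub>M\<^esub> (h z x y \<oplus>\<^bsub>M\<^esub> c z (x \<otimes> y))"
    using assms by (simp add: c_left M.a_ac)
  then show ?thesis
    using assms by (simp add: c_right M.a_ac)
qed

lemma trace_Quad: "(\<lambda>x. c x x) \<in> Quad G M"
proof -
  \<comment> \<open>Additivity in the second slot follows from the first because the polarization is
    symmetric.\<close>
  have "c x (y \<otimes> z) \<oplus>\<^bsub>M\<^esub> c (y \<otimes> z) x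
      = (c x y \<oplus>\<^bsub>M\<^esub> c y x) \<oplus>\<^bsub>M\<^esub> (c x z \<oplus>\<^bsub>M\<^esub> c z x)"
    if "x \<in> carrier G" "y \<in> carrier G" "z \<in> carrier G" for x y z
    using polar_additive[of y z x] that by (simp add: M.a_ac)
  then have "bilinear_map G M (\<lambda>x y. c x y \<oplus>\<^bsub>M\<^esub> c y x)"
    unfolding bilinear_map_def hom_def by (auto simp: polar_additive)
  then have bilinear:
    "bilinear_map G M (\<lambda>x y. c (x \<otimes> y) (x \<otimes> y) \<ominus>\<^bsub>M\<^esub> c x x \<ominus>\<^bsub>M\<^esub> c y y)"
    unfolding bilinear_map_def hom_def by (auto simp: polarization)
  have "c (inv x) (inv x) = c x x" if x: "x \<in> carrier G" for x
  proof -
    \<comment> \<open>With \<open>B\<close> the polarization and \<open>q\<close> the trace, \<open>B(x, - x) = - B(x, x) = - 2 q(x)\<close>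
      and \<open>0 = q(x - x) = B(x, - x) + q(x) + q(- x)\<close>.\<close>
    let ?B = "\<lambda>x y. c x y \<oplus>\<^bsub>M\<^esub> c y x"
    \<comment> \<open>Additivity at \<open>\<one> \<otimes> \<one>\<close> reads
      \<open>B = B + B\<close>.\<close>
    have B0: "?B \<one> z = \<zero>\<^bsub>M\<^esub>" if "z \<in> carrier G" for z
      using polar_additive[of \<one> \<one> z] that by simp
    have q0: "c \<one> \<one> = \<zero>\<^bsub>M\<^esub>"
      using trace_mult[of \<one> \<one>] B0[of \<one>] by simp
    have "?B x x \<oplus>\<^bsub>M\<^esub> ?B (inv x) x = \<zero>\<^bsub>M\<^esub>"
      using polar_additive[of x "inv x" x] B0[of x] x by simp
    moreover have "?B x (inv x) \<oplus>\<^bsub>M\<^esub> (c x x \<oplus>\<^bsub>M\<^esub> c (inv x) (inv x)) = \<zero>\<^bsub>M\<^esub>"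
      using trace_mult[of x "inv x"] q0 x by simp
    ultimately have "(?B x (inv x) \<oplus>\<^bsub>M\<^esub> c x x) \<oplus>\<^bsub>M\<^esub> c (inv x) (inv x)
        = (?B x (inv x) \<oplus>\<^bsub>M\<^esub> c x x) \<oplus>\<^bsub>M\<^esub> c x x"
      using x by (simp add: M.a_ac)
    then show ?thesis
      using x by (simp del: M.add.m_assoc)
  qed
  then show ?thesis
    using bilinear unfolding Quad_def by auto
qed

end

section \<open>Sums of pairs and the elementary pairs they are built from\<close>

context group_with_coefficients
begin

text \<open>Finite sums unfold only when their terms lie in \<open>carrier M\<close>, so rewriting a
  pair is justified only on the carrier of \<open>G\<close>; this lemma makes that
  sufficient.\<close>

lemma additive_normal_pair_cong:
  assumes "additive_normal_pair G M h c"
    and "\<And>x y z. \<lbrakk>x \<in> carrier G; y \<in> carrier G; z \<in> carrier G\<rbrakk> \<Longrightarrow> h' x y z = h x y z"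
    and "\<And>x y. \<lbrakk>x \<in> carrier G; y \<in> carrier G\<rbrakk> \<Longrightarrow> c' x y = c x y"
  shows "additive_normal_pair G M h' c'"
proof -
  interpret additive_normal_pair G M h c by fact
  show ?thesis
    by unfold_locales (simp_all add: assms(2,3) h_additive c_right c_left)
qed

lemma additive_normal_pair_add:
  assumes "additive_normal_pair G M h c" "additive_normal_pair G M h' c'"
  shows "additive_normal_pair G M (\<lambda>x y z. h x y z \<oplus>\<^bsub>M\<^esub> h' x y z) (\<lambda>x y. c x y \<oplus>\<^bsub>M\<^esub> c' x y)"
proof -
  interpret N: additive_normal_pair G M h c by fact
  interpret N': additive_normal_pair G M h' c' by fact
  show ?thesis
  proof
    fix x y z assume xyz: "x \<in> carrier G" "y \<in> carrier G" "z \<in> carrier G"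
    have "h x y z \<oplus>\<^bsub>M\<^esub> h' x y z \<oplus>\<^bsub>M\<^esub> (c x (y \<otimes> z) \<oplus>\<^bsub>M\<^esub> c' x (y \<otimes> z))
        = (h x y z \<oplus>\<^bsub>M\<^esub> c x (y \<otimes> z)) \<oplus>\<^bsub>M\<^esub> (h' x y z \<oplus>\<^bsub>M\<^esub> c' x (y \<otimes> z))"
      using xyz by (simp add: M.a_ac)
    then show "h x y z \<oplus>\<^bsub>M\<^esub> h' x y z \<oplus>\<^bsub>M\<^esub> (c x (y \<otimes> z) \<oplus>\<^bsub>M\<^esub> c' x (y \<otimes> z))
        = c x y \<oplus>\<^bsub>M\<^esub> c' x y \<oplus>\<^bsub>M\<^esub> (c x z \<oplus>\<^bsub>M\<^esub> c' x z)"
      using xyz by (simp add: N.c_right N'.c_right M.a_ac)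
  qed (simp_all add: N.h_additive N'.h_additive N.c_left N'.c_left M.a_ac)
qed

lemma additive_normal_pair_zero:
  "additive_normal_pair G M (\<lambda>x y z. \<zero>\<^bsub>M\<^esub>) (\<lambda>x y. \<zero>\<^bsub>M\<^esub>)"
  by unfold_locales simp_all

lemma additive_normal_pair_finsum:
  assumes "finite I" "\<And>i. i \<in> I \<Longrightarrow> additive_normal_pair G M (h i) (c i)"
  shows "additive_normal_pair G M
    (\<lambda>x y z. \<Oplus>\<^bsub>M\<^esub>i\<in>I. h i x y z) (\<lambda>x y. \<Oplus>\<^bsub>M\<^esub>i\<in>I. c i x y)"
  using assms
proof (induction I rule: finite_induct)
  case empty
  then show ?case by (simp add: additive_normal_pair_zero)
next
  case (insert i I)
  have closed: "h j x y z \<in> carrier M" "c j x y \<in> carrier M"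
    if "j \<in> insert i I" "x \<in> carrier G" "y \<in> carrier G" "z \<in> carrier G" for j x y z
    using insert.prems[OF that(1)] that(2-)
    by (simp_all add: additive_normal_pair.h_closed additive_normal_pair.c_closed)
  have "additive_normal_pair G M (\<lambda>x y z. h i x y z \<oplus>\<^bsub>M\<^esub> (\<Oplus>\<^bsub>M\<^esub>i\<in>I. h i x y z))
      (\<lambda>x y. c i x y \<oplus>\<^bsub>M\<^esub> (\<Oplus>\<^bsub>M\<^esub>i\<in>I. c i x y))"
    by (rule additive_normal_pair_add) (simp_all add: insert)
  then show ?case
    by (rule additive_normal_pair_cong)
      (use insert.hyps closed in \<open>auto intro!: M.finsum_insert\<close>)
qed

text \<open>Writing \<open>i - j = s l\<close>, the difference contributes
  \<open>l (s m) = 0\<close>. Identities in \<open>M\<close> thereby reduce to divisibility of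
  integer coefficients.\<close>

lemma int_multiple_cong:
  fixes i j :: int
  assumes m: "m \<in> carrier M" and s: "[s] \<cdot>\<^bsub>M\<^esub> m = \<zero>\<^bsub>M\<^esub>" and dvd: "int s dvd i - j"
  shows "[i] \<cdot>\<^bsub>M\<^esub> m = [j] \<cdot>\<^bsub>M\<^esub> m"
proof -
  obtain l where "i - j = int s * l" using dvd ..
  then have i: "i = int s * l + j" by simp
  have "[(int s * l)] \<cdot>\<^bsub>M\<^esub> m = [l] \<cdot>\<^bsub>M\<^esub> ([int s] \<cdot>\<^bsub>M\<^esub> m)"
    using M.add.int_pow_pow[OF m, of l "int s"] by (simp add: mult.commute)
  also have "[int s] \<cdot>\<^bsub>M\<^esub> m = \<zero>\<^bsub>M\<^esub>"
    using s unfolding add_pow_def by (simp add: int_pow_int)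
  also have "[l] \<cdot>\<^bsub>M\<^esub> \<zero>\<^bsub>M\<^esub> = \<zero>\<^bsub>M\<^esub>" by simp
  finally show ?thesis
    using m by (simp add: i M.add.int_pow_mult)
qed

text \<open>Taking \<open>s = 0\<close> covers the free coordinates: divisibility by \<open>0\<close> is equality, and
  \<open>0 m = 0\<close> always holds.\<close>

lemma additive_normal_pair_bilinear:
  fixes u v :: "'a \<Rightarrow> int"
  assumes m: "m \<in> carrier M"
    and s: "[s] \<cdot>\<^bsub>M\<^esub> m = \<zero>\<^bsub>M\<^esub>" and s': "[s'] \<cdot>\<^bsub>M\<^esub> m = \<zero>\<^bsub>M\<^esub>"
    and u: "\<And>x y. \<lbrakk>x \<in> carrier G; y \<in> carrier G\<rbrakk> \<Longrightarrow> int s dvd u (x \<otimes> y) - (u x + u y)"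
    and v: "\<And>x y. \<lbrakk>x \<in> carrier G; y \<in> carrier G\<rbrakk> \<Longrightarrow> int s' dvd v (x \<otimes> y) - (v x + v y)"
  shows "additive_normal_pair G M (\<lambda>x y z. \<zero>\<^bsub>M\<^esub>) (\<lambda>x y. [(u x * v y)] \<cdot>\<^bsub>M\<^esub> m)"
proof
  fix x y z assume xyz: "x \<in> carrier G" "y \<in> carrier G" "z \<in> carrier G"
  have "[(u (x \<otimes> y) * v z)] \<cdot>\<^bsub>M\<^esub> m = [(u x * v z + u y * v z)] \<cdot>\<^bsub>M\<^esub> m"
    by (rule int_multiple_cong[OF m s])
      (use dvd_mult2[OF u[OF xyz(1,2)], of "v z"] in \<open>simp add: algebra_simps\<close>)
  then show "[(u (x \<otimes> y) * v z)] \<cdot>\<^bsub>M\<^esub> m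
      = \<zero>\<^bsub>M\<^esub> \<oplus>\<^bsub>M\<^esub> ([(u x * v z)] \<cdot>\<^bsub>M\<^esub> m \<oplus>\<^bsub>M\<^esub> [(u y * v z)] \<cdot>\<^bsub>M\<^esub> m)"
    using m by (simp add: M.add.int_pow_mult)
  have "[(u x * v (y \<otimes> z))] \<cdot>\<^bsub>M\<^esub> m = [(u x * v y + u x * v z)] \<cdot>\<^bsub>M\<^esub> m"
    by (rule int_multiple_cong[OF m s'])
      (use dvd_mult[OF v[OF xyz(2,3)], of "u x"] in \<open>simp add: algebra_simps\<close>)
  then show "\<zero>\<^bsub>M\<^esub> \<oplus>\<^bsub>M\<^esub> [(u x * v (y \<otimes> z))] \<cdot>\<^bsub>M\<^esub> m
      = [(u x * v y)] \<cdot>\<^bsub>M\<^esub> m \<oplus>\<^bsub>M\<^esub> [(u x * v z)] \<cdot>\<^bsub>M\<^esub> m"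
    using m by (simp add: M.add.int_pow_mult)
qed (use m in simp_all)

lemma additive_normal_pair_diagonal:
  fixes u :: "'a \<Rightarrow> int"
  assumes m: "m \<in> torsion_part M (gcd (2 * n) (n\<^sup>2))"
    and u: "\<And>x. x \<in> carrier G \<Longrightarrow> u x \<in> {0..<int n}"
    and u_mult: "\<And>x y. \<lbrakk>x \<in> carrier G; y \<in> carrier G\<rbrakk> \<Longrightarrow> u (x \<otimes> y) = (u x + u y) mod int n"
  shows "additive_normal_pair G M (\<lambda>x y z. h_component M n m (u x) (u y) (u z))
    (\<lambda>x y. [(u x * u y)] \<cdot>\<^bsub>M\<^esub> m)"
proof -
  have mM: "m \<in> carrier M" and m0: "[gcd (2 * n) (n\<^sup>2)] \<cdot>\<^bsub>M\<^esub> m = \<zero>\<^bsub>M\<^esub>"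
    using m by (auto simp: torsion_part_def)
  note multiple_cong = int_multiple_cong[OF mM m0]
  \<comment> \<open>The order bound on \<open>m\<close> is used in two ways: it kills multiples of
    \<open>2 n\<close> and multiples of \<open>n * n\<close>.\<close>
  have dvd2: "int (gcd (2 * n) (n\<^sup>2)) dvd 2 * int n * l" for l
    by (metis dvd_mult2 gcd_dvd1 int_dvd_int_iff of_nat_mult of_nat_numeral)
  have dvdsq: "int (gcd (2 * n) (n\<^sup>2)) dvd int n * int n * l" for l
    by (metis dvd_mult2 gcd_dvd2 int_dvd_int_iff of_nat_mult power2_eq_square)
  \<comment> \<open>The carry measures how far the representative \<open>u\<close> is from being
    additive, and \<open>h\<close> is \<open>u x\<close> times this carry.\<close>
  define carry where "carry y z = (if u y + u z \<ge> int n then int n else 0)" for y z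
  have h: "h_component M n m (u x) (u y) (u z) = [(u x * carry y z)] \<cdot>\<^bsub>M\<^esub> m" for x y z
    by (simp add: h_component_def carry_def add_pow_def)
  \<comment> \<open>The sum of two representatives lies below \<open>2 n\<close>, so reduction
    subtracts \<open>n\<close> at most once.\<close>
  have u_carry: "u (y \<otimes> z) = u y + u z - carry y z"
    if "y \<in> carrier G" "z \<in> carrier G" for y z
    using u[OF that(1)] u[OF that(2)] mod_pos_pos_trivial[of "u y + u z - int n" "int n"]
    by (auto simp: u_mult[OF that] carry_def)
  have carry: "\<exists>l. carry y z = int n * l" for y z
    by (auto simp: carry_def intro: exI[of _ 1] exI[of _ 0])
  show ?thesis
    unfolding h
  proof
    fix w x y z
    assume "w \<in> carrier G" "x \<in> carrier G" "y \<in> carrier G" "z \<in> carrier G"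
    note wxyz = this
    obtain l l' where l: "carry w x = int n * l" "carry y z = int n * l'" using carry by metis
    \<comment> \<open>The coefficients differ by minus a product of two carries, a multiple of
      \<open>n * n\<close>.\<close>
    have "[(u (w \<otimes> x) * carry y z)] \<cdot>\<^bsub>M\<^esub> m = [(u w * carry y z + u x * carry y z)] \<cdot>\<^bsub>M\<^esub> m"
      by (rule multiple_cong)
        (use dvdsq[of "- (l * l')"] in \<open>simp add: u_carry wxyz l algebra_simps\<close>)
    then show "[(u (w \<otimes> x) * carry y z)] \<cdot>\<^bsub>M\<^esub> m
        = [(u w * carry y z)] \<cdot>\<^bsub>M\<^esub> m \<oplus>\<^bsub>M\<^esub> [(u x * carry y z)] \<cdot>\<^bsub>M\<^esub> m"
      using mM by (simp add: M.add.int_pow_mult)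
  next
    fix x y z
    assume "x \<in> carrier G" "y \<in> carrier G" "z \<in> carrier G"
    note xyz = this
    \<comment> \<open>Here the carries cancel exactly over the integers.\<close>
    show "[(u x * carry y z)] \<cdot>\<^bsub>M\<^esub> m \<oplus>\<^bsub>M\<^esub> [(u x * u (y \<otimes> z))] \<cdot>\<^bsub>M\<^esub> m
        = [(u x * u y)] \<cdot>\<^bsub>M\<^esub> m \<oplus>\<^bsub>M\<^esub> [(u x * u z)] \<cdot>\<^bsub>M\<^esub> m"
      using mM by (simp add: u_carry xyz M.add.int_pow_mult[symmetric] algebra_simps)
    obtain l where l: "carry x y = int n * l" using carry by metis
    \<comment> \<open>The carry enters with sign minus on the left and plus on the right, so the
      coefficients differ by a multiple of \<open>2 n\<close>.\<close>
    have "[(u (x \<otimes> y) * u z)] \<cdot>\<^bsub>M\<^esub> m = [(u z * carry x y + (u x * u z + u y * u z))] \<cdot>\<^bsub>M\<^esub> m"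
      by (rule multiple_cong)
        (use dvd2[of "- (l * u z)"] in \<open>simp add: u_carry xyz l algebra_simps\<close>)
    then show "[(u (x \<otimes> y) * u z)] \<cdot>\<^bsub>M\<^esub> m
        = [(u z * carry x y)] \<cdot>\<^bsub>M\<^esub> m \<oplus>\<^bsub>M\<^esub> ([(u x * u z)] \<cdot>\<^bsub>M\<^esub> m \<oplus>\<^bsub>M\<^esub> [(u y * u z)] \<cdot>\<^bsub>M\<^esub> m)"
      using mM by (simp add: M.add.int_pow_mult)
  qed (use mM in simp_all)
qed

end

section \<open>Coordinates on the finitely generated group\<close>

lemma fst_mult_fg_group:
  "i \<in> {1..k} \<Longrightarrow> fst (x \<otimes>\<^bsub>fg_group k n r\<^esub> y) i = (fst x i + fst y i) mod int (n i)"
  by (simp add: fg_group_def mult_DirProd')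

lemma snd_mult_fg_group:
  "j \<in> {1..r} \<Longrightarrow> snd (x \<otimes>\<^bsub>fg_group k n r\<^esub> y) j = snd x j + snd y j"
  by (simp add: fg_group_def mult_DirProd')

text \<open>Positivity matters: \<open>integer_mod_group 0\<close> is the group of all integers,
  with no bounded representatives.\<close>

lemma fst_fg_group_range:
  "\<lbrakk>x \<in> carrier (fg_group k n r); i \<in> {1..k}; n i > 0\<rbrakk> \<Longrightarrow> fst x i \<in> {0..<int (n i)}"
  by (force simp: fg_group_def carrier_sum_group PiE_iff carrier_integer_mod_group)

lemma comm_group_fg_group: "comm_group (fg_group k n r)"
proof (rule group.group_comm_groupI)
  show "group (fg_group k n r)"
    unfolding fg_group_def by (intro DirProd_group sum_group) simp_all
  show "x \<otimes>\<^bsub>fg_group k n r\<^esub> y = y \<otimes>\<^bsub>fg_group k n r\<^esub> x" for x y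
    by (simp add: fg_group_def mult_DirProd' add.commute)
qed

lemma dvd_chain:
  fixes n :: "nat \<Rightarrow> nat"
  assumes "\<And>i. i \<in> {1..<k} \<Longrightarrow> n i dvd n (Suc i)" and "1 \<le> i" "i \<le> j" "j \<le> k"
  shows "n i dvd n j"
  using assms(3,2,4)
proof (induction j rule: dec_induct)
  case base
  show ?case by simp
next
  case (step j)
  then have "n i dvd n j" "n j dvd n (Suc j)" using assms(1)[of j] by auto
  then show ?case by (rule dvd_trans)
qed

section \<open>Assembling the five summands\<close>

theorem mainTheorem4:
  fixes M :: "('m, 'z) ring_scheme"
    and k r :: nat
    and n :: "nat \<Rightarrow> nat"
    and m :: "nat \<Rightarrow> 'm" and b :: "nat \<Rightarrow> nat \<Rightarrow> 'm"
    and ell :: "nat \<Rightarrow> 'm" and f :: "nat \<Rightarrow> nat \<Rightarrow> 'm"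
    and t :: "nat \<Rightarrow> nat \<Rightarrow> 'm"
  defines "G \<equiv> fg_group k n r"
    and "q \<equiv> q_form M k r m b ell f t"
    and "c \<equiv> c_map M k r m b ell f t"
    and "h \<equiv> h_map M k n m"
  assumes "abelian_group M"
    and "\<And>i. i \<in> {1..k} \<Longrightarrow> n i > 0"
    and "\<And>i. i \<in> {1..<k} \<Longrightarrow> n i dvd n (Suc i)"
    and "\<And>i. i \<in> {1..k} \<Longrightarrow> m i \<in> torsion_part M (gcd (2 * n i) ((n i)\<^sup>2))"
    and "\<And>i j. 1 \<le> i \<Longrightarrow> i < j \<Longrightarrow> j \<le> k \<Longrightarrow> b i j \<in> torsion_part M (n i)"
    and "\<And>j. j \<in> {1..r} \<Longrightarrow> ell j \<in> carrier M"
    and "\<And>j l. 1 \<le> j \<Longrightarrow> j < l \<Longrightarrow> l \<le> r \<Longrightarrow> f j l \<in> carrier M"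
    and "\<And>i j. i \<in> {1..k} \<Longrightarrow> j \<in> {1..r} \<Longrightarrow> t i j \<in> torsion_part M (n i)"
  shows "q \<in> Quad G M \<and>
         two_abelian_3_cocycle G M h c \<and>
         in_normal_form G M h c \<and>
         (\<forall>g\<in>carrier G. c g g = q g)"
proof -
  interpret M: abelian_group M by fact
  interpret group_with_coefficients G M
    unfolding G_def by (intro group_with_coefficients.intro comm_group_fg_group) fact
  let ?N = "additive_normal_pair G M"
  have a: "int (n i) dvd fst (x \<otimes>\<^bsub>G\<^esub> y) i - (fst x i + fst y i)" if "i \<in> {1..k}" for i x y
    unfolding G_def fst_mult_fg_group[OF that] by (simp add: mod_eq_dvd_iff[symmetric])
  have x: "int 0 dvd snd (x \<otimes>\<^bsub>G\<^esub> y) j - (snd x j + snd y j)" if "j \<in> {1..r}" for j x y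
    unfolding G_def snd_mult_fg_group[OF that] by simp
  have torsion: "m \<in> carrier M" "[s] \<cdot>\<^bsub>M\<^esub> m = \<zero>\<^bsub>M\<^esub>" if "m \<in> torsion_part M s" for m s
    using that by (simp_all add: torsion_part_def)
  have diagonal: "?N (\<lambda>g g' g''. \<Oplus>\<^bsub>M\<^esub>i\<in>{1..k}. h_component M (n i) (m i) (fst g i) (fst g' i) (fst g'' i))
      (\<lambda>g g'. \<Oplus>\<^bsub>M\<^esub>i\<in>{1..k}. [(fst g i * fst g' i)] \<cdot>\<^bsub>M\<^esub> m i)"
    by (intro additive_normal_pair_finsum additive_normal_pair_diagonal)
      (simp_all add: assms fst_mult_fg_group fst_fg_group_range del: atLeastLessThan_iff)
  \<comment> \<open>The zero \<open>h\<close> is written as a double sum of zeros to match the shape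
    of \<open>additive_normal_pair_finsum\<close>.\<close>
  have bterm: "?N (\<lambda>g g' g''. \<Oplus>\<^bsub>M\<^esub>i\<in>{1..k}. \<Oplus>\<^bsub>M\<^esub>j\<in>{i<..k}. \<zero>\<^bsub>M\<^esub>)
      (\<lambda>g g'. \<Oplus>\<^bsub>M\<^esub>i\<in>{1..k}. \<Oplus>\<^bsub>M\<^esub>j\<in>{i<..k}. [(fst g i * fst g' j)] \<cdot>\<^bsub>M\<^esub> b i j)"
  proof (intro additive_normal_pair_finsum)
    fix i j assume "i \<in> {1..k}" "j \<in> {i<..k}"
    then have ij: "i \<in> {1..k}" "j \<in> {1..k}" "1 \<le> i" "i < j" "j \<le> k" by auto
    have b: "b i j \<in> carrier M" "[n i] \<cdot>\<^bsub>M\<^esub> b i j = \<zero>\<^bsub>M\<^esub>"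
      using torsion assms(9)[OF ij(3-5)] by auto
    \<comment> \<open>\<open>b i j\<close> is killed by \<open>n i\<close>, while coordinate
      \<open>j\<close> is additive modulo \<open>n j\<close>; the divisibility chain makes
      \<open>n i\<close> a common modulus for both coordinates.\<close>
    have "n i dvd n j"
      using dvd_chain[of k n i j] assms(7) ij by simp
    then have "int (n i) dvd fst (x \<otimes>\<^bsub>G\<^esub> y) j - (fst x j + fst y j)" for x y
      using a[OF ij(2)] by (meson dvd_trans of_nat_dvd_iff)
    with b a[OF ij(1)]
    show "?N (\<lambda>g g' g''. \<zero>\<^bsub>M\<^esub>) (\<lambda>g g'. [(fst g i * fst g' j)] \<cdot>\<^bsub>M\<^esub> b i j)"
      by (intro additive_normal_pair_bilinear[where s = "n i" and s' = "n i"])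
  qed simp_all
  have ellterm: "?N (\<lambda>g g' g''. \<Oplus>\<^bsub>M\<^esub>j\<in>{1..r}. \<zero>\<^bsub>M\<^esub>)
      (\<lambda>g g'. \<Oplus>\<^bsub>M\<^esub>j\<in>{1..r}. [(snd g j * snd g' j)] \<cdot>\<^bsub>M\<^esub> ell j)"
    by (intro additive_normal_pair_finsum additive_normal_pair_bilinear[where s = 0 and s' = 0] x)
      (simp_all add: assms)
  have fterm: "?N (\<lambda>g g' g''. \<Oplus>\<^bsub>M\<^esub>j\<in>{1..r}. \<Oplus>\<^bsub>M\<^esub>l\<in>{j<..r}. \<zero>\<^bsub>M\<^esub>)
      (\<lambda>g g'. \<Oplus>\<^bsub>M\<^esub>j\<in>{1..r}. \<Oplus>\<^bsub>M\<^esub>l\<in>{j<..r}. [(snd g j * snd g' l)] \<cdot>\<^bsub>M\<^esub> f j l)"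
    by (intro additive_normal_pair_finsum additive_normal_pair_bilinear[where s = 0 and s' = 0] x)
      (simp_all add: assms)
  have tterm: "?N (\<lambda>g g' g''. \<Oplus>\<^bsub>M\<^esub>i\<in>{1..k}. \<Oplus>\<^bsub>M\<^esub>j\<in>{1..r}. \<zero>\<^bsub>M\<^esub>)
      (\<lambda>g g'. \<Oplus>\<^bsub>M\<^esub>i\<in>{1..k}. \<Oplus>\<^bsub>M\<^esub>j\<in>{1..r}. [(fst g i * snd g' j)] \<cdot>\<^bsub>M\<^esub> t i j)"
  proof (intro additive_normal_pair_finsum)
    fix i j assume ij: "i \<in> {1..k}" "j \<in> {1..r}"
    have "t i j \<in> carrier M" "[n i] \<cdot>\<^bsub>M\<^esub> t i j = \<zero>\<^bsub>M\<^esub>"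
      using torsion assms(12)[OF ij] by auto
    then show "?N (\<lambda>g g' g''. \<zero>\<^bsub>M\<^esub>) (\<lambda>g g'. [(fst g i * snd g' j)] \<cdot>\<^bsub>M\<^esub> t i j)"
      \<comment> \<open>The torsion coordinate is additive modulo \<open>n i\<close>, the free one
        exactly, hence the modulus \<open>0\<close>.\<close>
      by (intro additive_normal_pair_bilinear[where s = "n i" and s' = 0] a x ij) simp_all
  qed simp_all
  \<comment> \<open>Only the diagonal summand contributes to \<open>h\<close>; its closedness allows
    the added zeros to be dropped.\<close>
  have "?N h c"
    by (rule additive_normal_pair_cong[OF additive_normal_pair_add[OF additive_normal_pair_add[OF
            additive_normal_pair_add[OF additive_normal_pair_add[OF diagonal bterm] ellterm] fterm] tterm]])
      (use additive_normal_pair.h_closed[OF diagonal] in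
        \<open>simp_all add: h_def c_def h_map_def c_map_def case_prod_unfold\<close>)
  then interpret N: additive_normal_pair G M h c .
  \<comment> \<open>The two functions agree everywhere, not just on the carrier, so membership in
    \<open>Quad G M\<close> transfers by rewriting.\<close>
  have "q = (\<lambda>g. c g g)"
    by (simp add: q_def c_def q_form_def c_map_def case_prod_unfold power2_eq_square)
  then show ?thesis
    using N.trace_Quad N.cocycle N.normal_form by simp
qed

end
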